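(* Let $C$ be a $C_{ab}$ curve with defining polynomial $F(x,y)=\sum_{(i,j)\in D}c_{i,j}x^iy^j$, and let $J(a,b)$, $\Omega$, $\overline{\rm mod}$, $\underline{\rm mod}$ be as defined in the context. For $(i,j)\in J(a,b)$ put $$\begin{aligned} r_{i,j}(z,w)={}&\sum_{0\le u\leq j}\ \sum_{r,s}c_{r,u}c_{s,j+1}\,u\,(s-i-1)\,z^{r+s-i-2}w^{u-1}\\ &+\sum_{j+1\leq v\le a}\ \sum_{r,s}c_{r,j+1}c_{s,v}\,(j+1)(r-i-1)\,z^{r+s-i-2}w^{v-1}\\ &+\sum_{0\le u\leq j}\ \sum_{j+2\leq v\le a}\ \sum_{r,s}c_{r,u}c_{s,v}\{(i+1)(v-u)-(j+1-u)s-(v-j-1)r\}\,z^{r+s-i-2}w^{u+v-j-2},\end{aligned}$$ where in the first line $(r,s)$ ranges over the pairs with $(r,u),(s,j+1)\in D$ and $s\ge i+2$; in the second line over the pairs with $(r,j+1),(s,v)\in D$ and $r\ge i+2$; and in the third line over the pairs with $(r,u),(s,v)\in D$, $(j+1-u)s+(v-j-1)r\le (i+1)(v-u)$ and $r+s\ge i+2$. For points $(x,y),(z,w)$ of the affine curve $F=0$ set $$R((x,y),(z,w)):=\frac{d}{dz}\Omega((x,y),(z,w))+\sum_{(i,j)\in J(a,b)}\frac{x^iy^j}{\frac{\partial F}{\partial y}(x,y)}\cdot\frac{r_{i,j}(z,w)}{\frac{\partial F}{\partial w}(z,w)} .$$ Then $R$ is symmetric, i.e. $R((x,y),(z,w))=R((z,w),(x,y))$,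 and $$R((x,y),(z,w))=\frac{G((x,y),(z,w))}{(x-z)^2\,\frac{\partial F}{\partial y}(x,y)\,\frac{\partial F}{\partial w}(z,w)},$$ where $$G((x,y),(z,w))=\sum_{u=0}^aG^{(12)}_{u,u}+\sum_{0\le u<v\le a}\big\{G^{(12)}_{u,v}+G^{(34)}_{u,v}+G^{(5)}_{u,v}\big\},$$ $$G^{(12)}_{u,v}=u\sum_{r}\sum_{s}c_{r,u}c_{s,v}x^rz^sy^{u-1}w^{v-1},\qquad G^{(34)}_{u,v}=u\sum_{r}\sum_{s}c_{r,u}c_{s,v}x^sz^ry^{v-1}w^{u-1},$$ $$\begin{aligned}G^{(5)}_{u,v}=-\sum_{k=u+1}^{v-1}\sum_{r}\sum_{s}c_{r,u}c_{s,v}\Big\{&\overline{\rm mod}\big((k-u)s+(v-k)r,\,v-u\big)\,z^{\left\lceil\frac{(k-u)s+(v-k)r}{v-u}\right\rceil}x^{\left\lfloor\frac{(k-u)r+(v-k)s}{v-u}\right\rfloor}\\ &+\underline{\rm mod}\big((k-u)r+(v-k)s,\,v-u\big)\,z^{\left\lfloor\frac{(k-u)s+(v-k)r}{v-u}\right\rfloor}x^{\left\lceil\frac{(k-u)r+(v-k)s}{v-u}\right\rceil}\Big\}w^{k-1}y^{u+v-k-1},\end{aligned}$$ the sums in $G^{(12)}_{u,v},G^{(34)}_{u,v},G^{(5)}_{u,v}$ being over all $r,s$ with $(r,u)\in D$ and $(s,v)\in D$.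
   Context: Setting ($C_{ab}$ curve). Let $a,b$ be mutually prime positive integers, $D:=\{(i,j)\in\mathbb Z^2 : ai+bj\le ab,\ 0\le i\le b,\ 0\le j\le a\}$, and $F(x,y)=\sum_{(i,j)\in D}c_{i,j}x^iy^j$ with $c_{i,j}\in\mathbb C$, such that at each $(x,y)$ with $F(x,y)=0$ at least one of $\frac{\partial F}{\partial x}(x,y)$, $\frac{\partial F}{\partial y}(x,y)$ is nonzero. $C$ is the compact Riemann surface whose affine part is $F(x,y)=0$, with a unique further point $\mathcal O$ (at infinity), at which the functions $x$ and $y$ have poles of orders $a$ and $b$ respectively. $J(a,b):=\{(i,j)\in\mathbb Z^2 : i,j\ge 0,\ ai+bj\le ab-a-b\}$. The points $(x,y)$ and $(z,w)$ both lie on $C$, so $F(x,y)=0$ and $F(z,w)=0$. Define $$\Omega((x,y),(z,w)):=\frac{H}{(x-z)\,\frac{\partial F}{\partial y}(x,y)},\qquad H:=\frac{F(z,y)-F(z,w)}{y-w}$$ (so $H$ is a polynomial in $z,y,w$). The derivative $\frac{d}{dz}$ is taken along the curve in the variable point $(z,w)$ with $(x,y)$ fixed, i.e. with $\frac{dw}{dz}=-\frac{\partial F}{\partial z}(z,w)\big/\frac{\partial F}{\partial w}(z,w)$. For integers $\alpha\ge 0$, $\beta>0$: $\underline{\rm mod}(\alpha,\beta):=\alpha-\lfloor\alpha/\beta\rfloor\beta$, and $\overline{\rm mod}(\alpha,\beta):=\underline{\rm mod}(\alpha,\beta)$ if this is nonzero, $\overline{\rm mod}(\alpha,\beta):=\beta$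 otherwise. $\lceil\cdot\rceil$, $\lfloor\cdot\rfloor$ are ceiling and floor. Empty sums are $0$, and any term with numerical factor $0$ is $0$ (e.g. terms with the factor $u$ when $u=0$).
   Formalization: In the third line of r_{i,j} the condition (j+1-u)s+(v-j-1)r ≤ (i+1)(v-u) is replaced by ≥; with ≤ the claim fails, e.g. F = y²-x³-1 gives R((0,1),(2,3)) = 0 but R((2,3),(0,1)) = 1/6. *)

theory Defs
  imports "HOL-Complex_Analysis.Complex_Analysis"
begin

section \<open>The defining polynomial\<close>

definition cab_D :: "nat \<Rightarrow> nat \<Rightarrow> (nat \<times> nat) set" where
  "cab_D a b = {(i, j). a * i + b * j \<le> a * b \<and> i \<le> b \<and> j \<le> a}"

text \<open>The bound \<open>a i + b j \<le> a b - a - b\<close> is an inequality of integers whose right-hand side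
  may be negative; hence the additive form.\<close>

definition cab_J :: "nat \<Rightarrow> nat \<Rightarrow> (nat \<times> nat) set" where
  "cab_J a b = {(i, j). a * i + b * j + a + b \<le> a * b}"

definition cab_F :: "nat \<Rightarrow> nat \<Rightarrow> (nat \<Rightarrow> nat \<Rightarrow> complex) \<Rightarrow> complex \<Rightarrow> complex \<Rightarrow> complex" where
  "cab_F a b c x y = (\<Sum>(i, j)\<in>cab_D a b. c i j * x ^ i * y ^ j)"

definition cab_Fx :: "nat \<Rightarrow> nat \<Rightarrow> (nat \<Rightarrow> nat \<Rightarrow> complex) \<Rightarrow> complex \<Rightarrow> complex \<Rightarrow> complex" where
  "cab_Fx a b c x y = deriv (\<lambda>\<xi>. cab_F a b c \<xi> y) x"

definition cab_Fy :: "nat \<Rightarrow> nat \<Rightarrow> (nat \<Rightarrow> nat \<Rightarrow> complex) \<Rightarrow> complex \<Rightarrow> complex \<Rightarrow> complex" where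
  "cab_Fy a b c x y = deriv (\<lambda>\<eta>. cab_F a b c x \<eta>) y"


section \<open>The curve\<close>

definition cab_affine :: "nat \<Rightarrow> nat \<Rightarrow> (nat \<Rightarrow> nat \<Rightarrow> complex) \<Rightarrow> (complex \<times> complex) set" where
  "cab_affine a b c = {(x, y). cab_F a b c x y = 0}"

text \<open>The smooth affine curve becomes a compact Riemann surface by adding one point: there is a
  chart \<open>t \<mapsto> (X t, Y t)\<close> from a punctured disc onto a punctured neighbourhood of the added
  point (\<open>t = 0\<close>), the rest of the affine curve is compact, and the coordinate functions
  have poles of orders \<open>a\<close> and \<open>b\<close> at the added point.\<close>

definition cab_point_at_infinity ::
    "nat \<Rightarrow> nat \<Rightarrow> (nat \<Rightarrow> nat \<Rightarrow> complex) \<Rightarrow> bool" where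
  "cab_point_at_infinity a b c \<longleftrightarrow>
    (\<exists>\<epsilon> X Y. let U = ball 0 \<epsilon> - {0 :: complex}; \<gamma> = (\<lambda>t. (X t, Y t)) in
       \<epsilon> > 0 \<and>
       X holomorphic_on U \<and> is_pole X 0 \<and> zorder X 0 = - int a \<and>
       Y holomorphic_on U \<and> is_pole Y 0 \<and> zorder Y 0 = - int b \<and>
       inj_on \<gamma> U \<and> \<gamma> ` U \<subseteq> cab_affine a b c \<and> compact (cab_affine a b c - \<gamma> ` U))"

definition cab_curve :: "nat \<Rightarrow> nat \<Rightarrow> (nat \<Rightarrow> nat \<Rightarrow> complex) \<Rightarrow> bool" where
  "cab_curve a b c \<longleftrightarrow>
     a > 0 \<and> b > 0 \<and> coprime a b \<and>
     (\<forall>x y. cab_F a b c x y = 0 \<longrightarrow> cab_Fx a b c x y \<noteq> 0 \<or> cab_Fy a b c x y \<noteq> 0) \<and>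
     cab_point_at_infinity a b c"


section \<open>The function \<open>\<Omega>\<close> and its derivative along the curve\<close>

text \<open>\<open>(F(z,y) - F(z,w)) / (y - w)\<close> is a polynomial in \<open>z, y, w\<close> (see \<open>cab_H_poly\<close> below);
  the first branch is its value on the diagonal \<open>y = w\<close>.\<close>

definition cab_H :: "nat \<Rightarrow> nat \<Rightarrow> (nat \<Rightarrow> nat \<Rightarrow> complex) \<Rightarrow>
    complex \<Rightarrow> complex \<Rightarrow> complex \<Rightarrow> complex" where
  "cab_H a b c z y w =
    (if y = w then cab_Fy a b c z w
     else (cab_F a b c z y - cab_F a b c z w) / (y - w))"

definition cab_Omega :: "nat \<Rightarrow> nat \<Rightarrow> (nat \<Rightarrow> nat \<Rightarrow> complex) \<Rightarrow>
    complex \<times> complex \<Rightarrow> complex \<times> complex \<Rightarrow> complex" where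
  "cab_Omega a b c = (\<lambda>(x, y) (z, w). cab_H a b c z y w / ((x - z) * cab_Fy a b c x y))"

text \<open>\<open>d/dz\<close> along the curve, that is with \<open>dw/dz = - (\<partial>F/\<partial>z) / (\<partial>F/\<partial>w)\<close>; the lemma
  \<open>cab_ddz_along_branch\<close> below relates it to local branches \<open>w = \<phi>(z)\<close>.\<close>

definition cab_ddz :: "nat \<Rightarrow> nat \<Rightarrow> (nat \<Rightarrow> nat \<Rightarrow> complex) \<Rightarrow>
    (complex \<times> complex \<Rightarrow> complex) \<Rightarrow> complex \<times> complex \<Rightarrow> complex" where
  "cab_ddz a b c f = (\<lambda>(z, w).
     deriv (\<lambda>\<zeta>. f (\<zeta>, w)) z +
     deriv (\<lambda>\<omega>. f (z, \<omega>)) w * (- cab_Fx a b c z w / cab_Fy a b c z w))"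


section \<open>The polynomials \<open>r\<^sub>i\<^sub>j\<close> and the function \<open>R\<close>\<close>

text \<open>Throughout, terms with \<open>w ^ (u - 1)\<close> (truncated subtraction) carry the factor \<open>u\<close>, and the
  other truncated differences are non-negative on the index sets used.

  In the third sum the inequality between \<open>(j+1-u) s + (v-j-1) r\<close> and \<open>(i+1) (v-u)\<close> is \<open>\<ge>\<close>.
  It is printed as \<open>\<le>\<close> in the source, but with \<open>\<le>\<close> the function \<open>R\<close> is not symmetric: for
  \<open>F = y^2 - x^3 - 1\<close> (\<open>a = 2\<close>, \<open>b = 3\<close>) one would have \<open>r\<^sub>0\<^sub>0 = 0\<close> and
  \<open>R((0,1),(2,3)) = 0\<close>, \<open>R((2,3),(0,1)) = 1/6\<close>.\<close>

definition cab_r :: "nat \<Rightarrow> nat \<Rightarrow> (nat \<Rightarrow> nat \<Rightarrow> complex) \<Rightarrow>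
    nat \<Rightarrow> nat \<Rightarrow> complex \<times> complex \<Rightarrow> complex" where
  "cab_r a b c i j = (\<lambda>(z, w).
     (\<Sum>u\<in>{0..j}. \<Sum>(r, s)\<in>{(r, s). (r, u) \<in> cab_D a b \<and> (s, j + 1) \<in> cab_D a b \<and> i + 2 \<le> s}.
        c r u * c s (j + 1) * of_nat u * (of_nat s - of_nat i - 1)
          * z ^ (r + s - i - 2) * w ^ (u - 1))
   + (\<Sum>v\<in>{j + 1..a}. \<Sum>(r, s)\<in>{(r, s). (r, j + 1) \<in> cab_D a b \<and> (s, v) \<in> cab_D a b \<and> i + 2 \<le> r}.
        c r (j + 1) * c s v * (of_nat j + 1) * (of_nat r - of_nat i - 1)
          * z ^ (r + s - i - 2) * w ^ (v - 1))
   + (\<Sum>u\<in>{0..j}. \<Sum>v\<in>{j + 2..a}. \<Sum>(r, s)\<in>{(r, s). (r, u) \<in> cab_D a b \<and> (s, v) \<in> cab_D a b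
            \<and> (j + 1 - u) * s + (v - j - 1) * r \<ge> (i + 1) * (v - u) \<and> r + s \<ge> i + 2}.
        c r u * c s v
          * ((of_nat i + 1) * (of_nat v - of_nat u)
             - (of_nat j + 1 - of_nat u) * of_nat s
             - (of_nat v - of_nat j - 1) * of_nat r)
          * z ^ (r + s - i - 2) * w ^ (u + v - j - 2)))"

definition cab_R :: "nat \<Rightarrow> nat \<Rightarrow> (nat \<Rightarrow> nat \<Rightarrow> complex) \<Rightarrow>
    complex \<times> complex \<Rightarrow> complex \<times> complex \<Rightarrow> complex" where
  "cab_R a b c = (\<lambda>(x, y) (z, w).
     cab_ddz a b c (cab_Omega a b c (x, y)) (z, w)
   + (\<Sum>(i, j)\<in>cab_J a b.
        x ^ i * y ^ j / cab_Fy a b c x y * (cab_r a b c i j (z, w) / cab_Fy a b c z w)))"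


section \<open>The numerator \<open>G\<close>\<close>

abbreviation mod_lower :: "nat \<Rightarrow> nat \<Rightarrow> nat" where
  "mod_lower \<alpha> \<beta> \<equiv> \<alpha> mod \<beta>"

definition mod_upper :: "nat \<Rightarrow> nat \<Rightarrow> nat" where
  "mod_upper \<alpha> \<beta> = (if mod_lower \<alpha> \<beta> \<noteq> 0 then mod_lower \<alpha> \<beta> else \<beta>)"

definition floor_quot :: "nat \<Rightarrow> nat \<Rightarrow> nat" where
  "floor_quot \<alpha> \<beta> = nat \<lfloor>real \<alpha> / real \<beta>\<rfloor>"

definition ceiling_quot :: "nat \<Rightarrow> nat \<Rightarrow> nat" where
  "ceiling_quot \<alpha> \<beta> = nat \<lceil>real \<alpha> / real \<beta>\<rceil>"

definition cab_col :: "nat \<Rightarrow> nat \<Rightarrow> nat \<Rightarrow> nat set" where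
  "cab_col a b u = {r. (r, u) \<in> cab_D a b}"

definition cab_G12 :: "nat \<Rightarrow> nat \<Rightarrow> (nat \<Rightarrow> nat \<Rightarrow> complex) \<Rightarrow>
    complex \<times> complex \<Rightarrow> complex \<times> complex \<Rightarrow> nat \<Rightarrow> nat \<Rightarrow> complex" where
  "cab_G12 a b c = (\<lambda>(x, y) (z, w) u v.
     of_nat u * (\<Sum>r\<in>cab_col a b u. \<Sum>s\<in>cab_col a b v.
       c r u * c s v * x ^ r * z ^ s * y ^ (u - 1) * w ^ (v - 1)))"

definition cab_G34 :: "nat \<Rightarrow> nat \<Rightarrow> (nat \<Rightarrow> nat \<Rightarrow> complex) \<Rightarrow>
    complex \<times> complex \<Rightarrow> complex \<times> complex \<Rightarrow> nat \<Rightarrow> nat \<Rightarrow> complex" where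
  "cab_G34 a b c = (\<lambda>(x, y) (z, w) u v.
     of_nat u * (\<Sum>r\<in>cab_col a b u. \<Sum>s\<in>cab_col a b v.
       c r u * c s v * x ^ s * z ^ r * y ^ (v - 1) * w ^ (u - 1)))"

definition cab_G5 :: "nat \<Rightarrow> nat \<Rightarrow> (nat \<Rightarrow> nat \<Rightarrow> complex) \<Rightarrow>
    complex \<times> complex \<Rightarrow> complex \<times> complex \<Rightarrow> nat \<Rightarrow> nat \<Rightarrow> complex" where
  "cab_G5 a b c = (\<lambda>(x, y) (z, w) u v.
     - (\<Sum>k\<in>{u + 1..v - 1}. \<Sum>r\<in>cab_col a b u. \<Sum>s\<in>cab_col a b v.
         c r u * c s v *
         (of_nat (mod_upper ((k - u) * s + (v - k) * r) (v - u))
            * z ^ ceiling_quot ((k - u) * s + (v - k) * r) (v - u)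
            * x ^ floor_quot ((k - u) * r + (v - k) * s) (v - u)
          + of_nat (mod_lower ((k - u) * r + (v - k) * s) (v - u))
            * z ^ floor_quot ((k - u) * s + (v - k) * r) (v - u)
            * x ^ ceiling_quot ((k - u) * r + (v - k) * s) (v - u))
         * w ^ (k - 1) * y ^ (u + v - k - 1)))"

definition cab_G :: "nat \<Rightarrow> nat \<Rightarrow> (nat \<Rightarrow> nat \<Rightarrow> complex) \<Rightarrow>
    complex \<times> complex \<Rightarrow> complex \<times> complex \<Rightarrow> complex" where
  "cab_G a b c P Q =
     (\<Sum>u\<in>{0..a}. cab_G12 a b c P Q u u)
   + (\<Sum>(u, v)\<in>{(u, v). u < v \<and> v \<le> a}.
        cab_G12 a b c P Q u v + cab_G34 a b c P Q u v + cab_G5 a b c P Q u v)"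


section \<open>Justification of the conventions\<close>

lemma finite_cab_D [simp]: "finite (cab_D a b)"
  by (rule finite_subset[of _ "{..b} \<times> {..a}"]) (auto simp: cab_D_def)

lemma cab_Fy_eq:
  "cab_Fy a b c x y = (\<Sum>(i, j)\<in>cab_D a b. c i j * x ^ i * (of_nat j * y ^ (j - 1)))"
  unfolding cab_Fy_def cab_F_def case_prod_beta
  by (rule DERIV_imp_deriv) (auto intro!: derivative_eq_intros sum.cong)

lemma cab_Fx_eq:
  "cab_Fx a b c x y = (\<Sum>(i, j)\<in>cab_D a b. c i j * (of_nat i * x ^ (i - 1)) * y ^ j)"
  unfolding cab_Fx_def cab_F_def case_prod_beta
  by (rule DERIV_imp_deriv) (auto intro!: derivative_eq_intros sum.cong)

lemma cab_H_poly:
  "cab_H a b c z y w =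
     (\<Sum>(i, j)\<in>cab_D a b. c i j * z ^ i * (\<Sum>k<j. w ^ (j - Suc k) * y ^ k))"
proof (cases "y = w")
  case True
  have "(\<Sum>k<j. w ^ (j - Suc k) * w ^ k) = of_nat j * w ^ (j - 1)" for j
  proof -
    have "(\<Sum>k<j. w ^ (j - Suc k) * w ^ k) = (\<Sum>k<j. w ^ (j - 1))"
      by (intro sum.cong) (auto simp flip: power_add)
    then show ?thesis by simp
  qed
  with True show ?thesis by (simp add: cab_H_def cab_Fy_eq)
next
  case False
  have "cab_F a b c z y - cab_F a b c z w =
      (\<Sum>(i, j)\<in>cab_D a b. c i j * z ^ i * (y ^ j - w ^ j))"
    by (simp add: cab_F_def case_prod_beta right_diff_distrib flip: sum_subtractf)
  also have "\<dots> = (\<Sum>(i, j)\<in>cab_D a b. c i j * z ^ i * (\<Sum>k<j. w ^ (j - Suc k) * y ^ k)) * (y - w)"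
    unfolding sum_distrib_right by (intro sum.cong) (auto simp: power_diff_sumr2 mult_ac)
  finally show ?thesis using False by (simp add: cab_H_def)
qed

text \<open>If the curve is locally the graph of \<open>\<phi>\<close>, then \<open>cab_ddz\<close> is the ordinary derivative of the
  restriction to that graph.\<close>

lemma has_derivative_along_graph:
  fixes f :: "complex \<times> complex \<Rightarrow> complex"
  assumes f: "(f has_derivative (\<lambda>(h, k). A * h + B * k)) (at (z, w))"
    and \<phi>: "(\<phi> has_field_derivative D) (at z)" "\<phi> z = w"
  shows "((\<lambda>\<zeta>. f (\<zeta>, \<phi> \<zeta>)) has_field_derivative A + B * D) (at z)"
proof -
  have g: "((\<lambda>\<zeta>. (\<zeta>, \<phi> \<zeta>)) has_derivative (\<lambda>h. (h, D * h))) (at z)"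
    using \<phi>(1) by (intro has_derivative_Pair has_derivative_ident)
      (simp add: has_field_derivative_def)
  have "(f has_derivative (\<lambda>(h, k). A * h + B * k)) (at (z, \<phi> z))"
    using f \<phi>(2) by simp
  from has_derivative_compose[OF g this] show ?thesis
    unfolding has_field_derivative_def
    by (rule has_derivative_eq_rhs) (auto simp: algebra_simps)
qed

lemma cab_F_has_derivative:
  "((\<lambda>(x, y). cab_F a b c x y) has_derivative
     (\<lambda>(h, k). cab_Fx a b c z w * h + cab_Fy a b c z w * k)) (at (z, w))"
  unfolding cab_F_def cab_Fx_eq cab_Fy_eq case_prod_beta
  by (rule derivative_eq_intros refl | simp)+
    (auto simp: sum_distrib_right sum_distrib_left sum.distrib[symmetric] algebra_simps
      intro!: ext sum.cong)

lemma cab_ddz_along_branch: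
  assumes f: "(f has_derivative (\<lambda>(h, k). A * h + B * k)) (at (z, w))"
    and \<phi>: "(\<phi> has_field_derivative D) (at z)" "\<phi> z = w"
    and F0: "eventually (\<lambda>\<zeta>. cab_F a b c \<zeta> (\<phi> \<zeta>) = 0) (nhds z)"
    and Fw: "cab_Fy a b c z w \<noteq> 0"
  shows "((\<lambda>\<zeta>. f (\<zeta>, \<phi> \<zeta>)) has_field_derivative cab_ddz a b c f (z, w)) (at z)"
proof -
  have "((\<lambda>\<zeta>. cab_F a b c \<zeta> (\<phi> \<zeta>)) has_field_derivative
      cab_Fx a b c z w + cab_Fy a b c z w * D) (at z)"
    using has_derivative_along_graph[OF cab_F_has_derivative \<phi>] by simp
  moreover have "((\<lambda>\<zeta>. cab_F a b c \<zeta> (\<phi> \<zeta>)) has_field_derivative 0) (at z)"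
    by (rule DERIV_cong_ev[OF refl F0 refl, THEN iffD2]) simp
  ultimately have "cab_Fx a b c z w + cab_Fy a b c z w * D = 0"
    by (rule DERIV_unique)
  then have D: "D = - cab_Fx a b c z w / cab_Fy a b c z w"
    using Fw by (simp add: field_simps add_eq_0_iff)
  have "deriv (\<lambda>\<zeta>. f (\<zeta>, w)) z = A"
    using has_derivative_along_graph[OF f, of "\<lambda>_. w" 0] by (auto intro: DERIV_imp_deriv)
  moreover have "deriv (\<lambda>\<omega>. f (z, \<omega>)) w = B"
  proof -
    have g: "((\<lambda>\<omega>. (z, \<omega>)) has_derivative (\<lambda>h. (0, h))) (at w)"
      by (auto intro!: derivative_eq_intros)
    have "((\<lambda>\<omega>. f (z, \<omega>)) has_field_derivative B) (at w)"
      using has_derivative_compose[OF g f] by (simp add: has_field_derivative_def)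
    then show ?thesis by (rule DERIV_imp_deriv)
  qed
  ultimately show ?thesis
    using has_derivative_along_graph[OF f \<phi>] by (simp add: cab_ddz_def D)
qed

end

theory Submission
  imports Defs
begin

text \<open>
  Write \<open>F(x,y) = \<Sum>\<^sub>u f\<^sub>u(x) y\<^sup>u\<close> and let \<open>C\<^sub>u = f\<^sub>u(z) + (x - z) f\<^sub>u'(z)\<close> be the first-order Taylor
  polynomial of \<open>f\<^sub>u\<close> at \<open>z\<close>.  After multiplication by \<open>(x - z)\<^sup>2 F\<^sub>y F\<^sub>w\<close>, the derivative of \<open>\<Omega>\<close>
  becomes a bilinear form in the \<open>C\<^sub>p\<close> and the \<open>f\<^sub>q(z)\<close>, which \<open>F(z,w) = 0\<close> brings to a shape
  where only the exponents of \<open>y\<close> between \<open>p - 1\<close> and \<open>q - 1\<close> occur.  In the polynomials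
  \<open>r\<^sub>i\<^sub>j\<close> the coefficients are truncated linear functions of \<open>i\<close>, so \<open>(x - z)\<^sup>2 \<Sum>\<^sub>i x\<^sup>i r\<^sub>i\<^sub>j\<close> consists of
  second differences: it contributes Taylor polynomials that cancel the \<open>C\<^sub>p\<close>, and the kink of
  the truncation, which yields the rounded exponents of \<open>G\<^sup>(\<^sup>5\<^sup>)\<close>.  The points outside
  \<open>J(a,b)\<close> do not matter because \<open>r\<^sub>i\<^sub>j\<close> vanishes there, by convexity of \<open>D\<close>.
\<close>

section \<open>Columns of the Newton polygon\<close>

definition col_poly :: "nat \<Rightarrow> nat \<Rightarrow> (nat \<Rightarrow> nat \<Rightarrow> complex) \<Rightarrow> nat \<Rightarrow> complex \<Rightarrow> complex" where
  "col_poly a b c u z = (\<Sum>r\<in>cab_col a b u. c r u * z ^ r)"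

text \<open>This is C_u of the overview, written coefficientwise; at \<open>r = 0\<close> the
  truncated exponent \<open>r - 1\<close> is harmless because of the factor
  \<open>of_nat r\<close>.\<close>

definition col_tangent ::
    "nat \<Rightarrow> nat \<Rightarrow> (nat \<Rightarrow> nat \<Rightarrow> complex) \<Rightarrow> nat \<Rightarrow> complex \<Rightarrow> complex \<Rightarrow> complex" where
  "col_tangent a b c u x z =
     (\<Sum>r\<in>cab_col a b u. c r u * (z ^ r + of_nat r * (x - z) * z ^ (r - 1)))"

lemma cab_col_le: "r \<in> cab_col a b u \<Longrightarrow> r \<le> b"
  by (auto simp: cab_col_def cab_D_def)

lemma finite_cab_col [simp]: "finite (cab_col a b u)"
  by (rule finite_subset[of _ "{..b}"]) (auto dest: cab_col_le)

lemma sum_cab_D: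
  "(\<Sum>(i, j)\<in>cab_D a b. g i j) = (\<Sum>j\<le>a. \<Sum>i\<in>cab_col a b j. g i j)"
proof -
  have "(\<Sum>j\<le>a. \<Sum>i\<in>cab_col a b j. g i j) = (\<Sum>(j, i)\<in>Sigma {..a} (cab_col a b). g i j)"
    by (rule sum.Sigma) auto
  also have "\<dots> = (\<Sum>(i, j)\<in>cab_D a b. g i j)"
    by (rule sum.reindex_bij_witness[of _ "\<lambda>(i, j). (j, i)" "\<lambda>(j, i). (i, j)"])
      (auto simp: cab_col_def cab_D_def)
  finally show ?thesis by simp
qed

section \<open>Pairs of columns\<close>

definition less_pairs :: "nat \<Rightarrow> (nat \<times> nat) set" where
  "less_pairs a = {(u, v). u < v \<and> v \<le> a}"

lemma less_pairs_iff [simp]: "(u, v) \<in> less_pairs a \<longleftrightarrow> u < v \<and> v \<le> a"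
  by (simp add: less_pairs_def)

lemma finite_less_pairs [simp]: "finite (less_pairs a)"
  by (rule finite_subset[of _ "{..a} \<times> {..a}"]) (auto simp: less_pairs_def)

text \<open>The square is the disjoint union of its diagonal, the pairs with \<open>u < v\<close>
  and their mirror images. Bilinear sums over all columns thus reach the index set of
  \<open>cab_G\<close>.\<close>

lemma sum_square_less_pairs:
  fixes h :: "nat \<Rightarrow> nat \<Rightarrow> 'a :: comm_monoid_add"
  shows "(\<Sum>p\<le>a. \<Sum>q\<le>a. h p q) =
    (\<Sum>u\<le>a. h u u) + (\<Sum>(u, v)\<in>less_pairs a. h u v + h v u)"
proof -
  let ?P = "less_pairs a"
  have "(\<Sum>p\<le>a. \<Sum>q\<le>a. h p q) = (\<Sum>(p, q)\<in>{..a} \<times> {..a}. h p q)"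
    by (simp add: sum.cartesian_product)
  also have "{..a} \<times> {..a} = (\<lambda>u. (u, u)) ` {..a} \<union> (?P \<union> prod.swap ` ?P)"
  proof -
    have "pr \<in> (\<lambda>u. (u, u)) ` {..a} \<union> (?P \<union> prod.swap ` ?P)" if "pr \<in> {..a} \<times> {..a}" for pr
      using that by (cases pr; cases "fst pr" "snd pr" rule: linorder_cases)
        (force simp: image_iff less_pairs_def)+
    then show ?thesis by (auto simp: less_pairs_def)
  qed
  also have "(\<Sum>(p, q)\<in>\<dots>. h p q) = (\<Sum>(p, q)\<in>(\<lambda>u. (u, u)) ` {..a}. h p q)
      + ((\<Sum>(p, q)\<in>?P. h p q) + (\<Sum>(p, q)\<in>prod.swap ` ?P. h p q))"
    by (subst sum.union_disjoint; (subst sum.union_disjoint)?) auto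
  also have "(\<Sum>(p, q)\<in>(\<lambda>u. (u, u)) ` {..a}. h p q) = (\<Sum>u\<le>a. h u u)"
    by (subst sum.reindex) (auto simp: inj_on_def)
  also have "(\<Sum>(p, q)\<in>prod.swap ` ?P. h p q) = (\<Sum>(u, v)\<in>?P. h v u)"
    by (subst sum.reindex) (auto simp: inj_on_def case_prod_beta)
  finally show ?thesis by (simp add: sum.distrib case_prod_beta)
qed

section \<open>Truncated linear weights\<close>

text \<open>Multiplying by the square of \<open>x - z\<close> takes second differences, which vanish
  for weights linear in \<open>i\<close>; only terms at the two ends survive. The bound
  \<open>q < n\<close> keeps every subtraction of exponents genuine.\<close>

lemma linear_weights_sum:
  fixes x z d M :: "'a :: comm_ring_1"
  assumes "q < n"
  shows "(x - z)\<^sup>2 * (\<Sum>i<q. ((of_nat i + 1) * d - M) * x ^ i * z ^ (n - i - 2)) =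
    d * z ^ n + M * (x - z) * z ^ (n - 1)
      - ((of_nat q + 1) * d - M) * x ^ q * z ^ (n - q)
      + (of_nat q * d - M) * x ^ Suc q * z ^ (n - q - 1)"
  using assms
proof (induction q)
  case 0
  then have "z ^ n = z * z ^ (n - 1)" by (cases n) auto
  then show ?case by (simp add: algebra_simps)
next
  case (Suc q)
  define m where "m = n - q - 2"
  define e where "e = (of_nat q + 1) * d - M"
  have m: "n - q - 2 = m" "n - q = Suc (Suc m)" "n - q - 1 = Suc m"
    "n - Suc q = Suc m" "n - Suc q - 1 = m"
    using Suc.prems by (auto simp: m_def)
  have e: "(of_nat (Suc q) + 1) * d - M = e + d" "of_nat (Suc q) * d - M = e"
    "of_nat q * d - M = e - d"
    by (simp_all add: e_def algebra_simps)
  have "(x - z)\<^sup>2 * (\<Sum>i<q. ((of_nat i + 1) * d - M) * x ^ i * z ^ (n - i - 2)) =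
      d * z ^ n + M * (x - z) * z ^ (n - 1) - e * x ^ q * z ^ Suc (Suc m) + (e - d) * x ^ Suc q * z ^ Suc m"
    using Suc unfolding m e e_def[symmetric] by simp
  then show ?case
    unfolding sum.lessThan_Suc distrib_left m e e_def[symmetric]
    by (simp add: algebra_simps power2_eq_square)
qed

text \<open>With t = M/d this is d times the linear interpolation, between the integers around t, of
  the monomials x^t z^(n-t).\<close>

definition rounding_term :: "'a :: comm_ring_1 \<Rightarrow> 'a \<Rightarrow> nat \<Rightarrow> nat \<Rightarrow> nat \<Rightarrow> 'a" where
  "rounding_term x z d M n =
     of_nat (d - M mod d) * x ^ (M div d) * z ^ (n - M div d)
     + of_nat (M mod d) * x ^ (M div d + 1) * z ^ (n - M div d - 1)"

text \<open>The coefficients of \<open>cab_r\<close>, as functions of \<open>i\<close>, all have the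
  form min(0, (i+1)d - M) up to sign and constant factors. The second guard keeps
  \<open>n - i - 2\<close> genuine.\<close>

definition truncated_weight :: "'a :: comm_ring_1 \<Rightarrow> nat \<Rightarrow> nat \<Rightarrow> nat \<Rightarrow> nat \<Rightarrow> 'a" where
  "truncated_weight z d M n i =
     (if (i + 1) * d \<le> M \<and> i + 2 \<le> n
      then ((of_nat i + 1) * of_nat d - of_nat M) * z ^ (n - i - 2) else 0)"

definition weighted_sum :: "'a :: comm_ring_1 \<Rightarrow> 'a \<Rightarrow> nat \<Rightarrow> (nat \<Rightarrow> 'a) \<Rightarrow> 'a" where
  "weighted_sum x z N f = (x - z)\<^sup>2 * (\<Sum>i<N. x ^ i * f i)"

lemma weighted_sum_add:
  "weighted_sum x z N (\<lambda>i. f i + g i) = weighted_sum x z N f + weighted_sum x z N g"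
  by (simp add: weighted_sum_def distrib_left sum.distrib)

lemma weighted_sum_cmult: "weighted_sum x z N (\<lambda>i. t * f i) = t * weighted_sum x z N f"
  by (simp add: weighted_sum_def sum_distrib_left mult_ac)

lemma weighted_sum_uminus: "weighted_sum x z N (\<lambda>i. - f i) = - weighted_sum x z N f"
  using weighted_sum_cmult[of x z N "-1" f] by simp

lemma weighted_sum_sum:
  "weighted_sum x z N (\<lambda>i. \<Sum>q\<in>S. f q i) = (\<Sum>q\<in>S. weighted_sum x z N (f q))"
  by (simp add: weighted_sum_def sum_distrib_left sum.swap[of _ S])

text \<open>The weight is linear up to the kink at \<open>M div d\<close> and zero beyond it, so
  \<open>linear_weights_sum\<close> applies. At the upper end its weights are
  \<open>d - M mod d\<close> and \<open>- (M mod d)\<close>, which form the rounding term. The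
  assumption on \<open>N\<close> ensures that the sum reaches the kink.\<close>

lemma weighted_sum_truncated_weight:
  fixes x z :: "'a :: comm_ring_1"
  assumes d: "0 < d" and M: "M \<le> d * n" and N: "M \<le> d * N"
  shows "weighted_sum x z N (truncated_weight z d M n) =
    of_nat d * z ^ n + of_nat M * (x - z) * z ^ (n - 1) - rounding_term x z d M n"
    (is "?S = ?R")
proof -
  define q where "q = M div d"
  define \<rho> where "\<rho> = M mod d"
  have M_eq: "M = q * d + \<rho>" and \<rho>: "\<rho> < d"
    using d by (auto simp: q_def \<rho>_def)
  have le_iff: "(i + 1) * d \<le> M \<longleftrightarrow> i < q" for i
    using d by (simp add: q_def less_eq_div_iff_mult_less_eq flip: Suc_le_eq)
  have qN: "q \<le> N" and qn: "q \<le> n"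
    using div_le_mono[OF N, of d] div_le_mono[OF M, of d] d by (simp_all add: q_def)
  \<comment> \<open>Here \<open>q\<close> comes from the truncation and \<open>n - 1\<close> from
    the guard \<open>i + 2 \<le> n\<close>.\<close>
  have S: "?S = (x - z)\<^sup>2 * (\<Sum>i<min q (n - 1). ((of_nat i + 1) * of_nat d - of_nat M) * x ^ i * z ^ (n - i - 2))"
    unfolding weighted_sum_def
    by (intro arg_cong[of _ _ "(*) _"] sum.mono_neutral_cong_right)
      (use qN in \<open>auto simp: truncated_weight_def le_iff[simplified]\<close>)
  show ?thesis
  proof (cases "q < n")
    case True
    then have "min q (n - 1) = q" by auto
    then show ?thesis
      unfolding S using linear_weights_sum[OF True, of x z "of_nat d" "of_nat M"] \<rho>
      by (simp flip: q_def \<rho>_def add: rounding_term_def M_eq of_nat_diff algebra_simps)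
  next
    \<comment> \<open>Now \<open>M = d * n\<close>; for positive \<open>n\<close> the guard drops
      the index \<open>n - 1\<close>, whose weight is zero anyway.\<close>
    case False
    then have q: "q = n" using qn by simp
    then have \<rho>0: "\<rho> = 0" using M M_eq by (simp add: mult.commute)
    show ?thesis
    proof (cases n)
      case 0
      then show ?thesis using q \<rho>0 M_eq
        by (simp flip: q_def \<rho>_def add: rounding_term_def weighted_sum_def truncated_weight_def)
    next
      case (Suc m)
      have "min q (n - 1) = m" using q Suc by auto
      then show ?thesis
        unfolding S using linear_weights_sum[of m n x z "of_nat d" "of_nat M"] Suc \<rho>0 q
        by (simp flip: q_def \<rho>_def add: rounding_term_def M_eq algebra_simps)
    qed
  qed
qed

section \<open>The derivative of \<open>\<Omega>\<close>\<close>

text \<open>The absolute value covers both orders of \<open>p\<close> and \<open>q\<close>; for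
  \<open>p = q\<close> the range is empty.\<close>

definition between_sum :: "complex \<Rightarrow> complex \<Rightarrow> nat \<Rightarrow> nat \<Rightarrow> complex" where
  "between_sum y w p q = (\<Sum>k\<in>{min p q<..<max p q}.
     of_int \<bar>int k - int q\<bar> * y ^ (k - 1) * w ^ (p + q - k - 1))"

text \<open>Both sides are combinations of the monomials \<open>m k\<close>, so integer coefficients
  can be compared for each \<open>k\<close>. The last term is kept apart because its factor
  \<open>w ^ q\<close> makes it disappear on the curve.\<close>

lemma divided_difference_pair:
  "(\<Sum>k<p. w ^ (p - Suc k) * y ^ k) * (of_nat q * w ^ (q - 1))
     - (\<Sum>k<q. of_nat (q - Suc k) * w ^ (q - Suc k - 1) * y ^ k) * w ^ p
   = of_nat (min p q) * y ^ (p - 1) * w ^ (q - 1) - between_sum y w p q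
     + w ^ q * (\<Sum>k\<in>{1..<p}. of_nat k * w ^ (p - k - 1) * y ^ (k - 1))"
proof -
  \<comment> \<open>A common range for all five expressions; missing coefficients are padded with
    zero.\<close>
  let ?I = "{1..p + q}"
  define m where "m k = y ^ (k - 1) * w ^ (p + q - k - 1)" for k
  have 1: "(\<Sum>k<p. w ^ (p - Suc k) * y ^ k) * (of_nat q * w ^ (q - 1)) =
      (\<Sum>k\<in>?I. of_int (if k \<le> p then int q else 0) * m k)"
  proof -
    have "(\<Sum>k<p. w ^ (p - Suc k) * y ^ k) * (of_nat q * w ^ (q - 1)) =
        (\<Sum>k\<in>{1..p}. of_nat q * m k)"
      unfolding sum_distrib_right
    proof (rule sum.reindex_bij_witness[of _ "\<lambda>k. k - 1" Suc])
      fix k assume k: "k \<in> {..<p}"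
      show "of_nat q * m (Suc k) = w ^ (p - Suc k) * y ^ k * (of_nat q * w ^ (q - 1))"
      proof (cases q)
        case (Suc q')
        have "p + q - Suc k - 1 = (p - Suc k) + (q - 1)" using k Suc by auto
        then show ?thesis by (simp add: m_def power_add)
      qed simp
    qed auto
    also have "\<dots> = (\<Sum>k\<in>?I. of_int (if k \<le> p then int q else 0) * m k)"
      by (rule sum.mono_neutral_cong_left) auto
    finally show ?thesis .
  qed
  have 2: "(\<Sum>k<q. of_nat (q - Suc k) * w ^ (q - Suc k - 1) * y ^ k) * w ^ p =
      (\<Sum>k\<in>?I. of_int (if k \<le> q then int q - int k else 0) * m k)"
  proof -
    have "(\<Sum>k<q. of_nat (q - Suc k) * w ^ (q - Suc k - 1) * y ^ k) * w ^ p =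
        (\<Sum>k\<in>{1..q}. of_nat (q - k) * m k)"
      unfolding sum_distrib_right
    proof (rule sum.reindex_bij_witness[of _ "\<lambda>k. k - 1" Suc])
      fix k assume k: "k \<in> {..<q}"
      show "of_nat (q - Suc k) * m (Suc k) =
          of_nat (q - Suc k) * w ^ (q - Suc k - 1) * y ^ k * w ^ p"
      proof (cases "q = Suc k")
        case False
        have "p + q - Suc k - 1 = (q - Suc k - 1) + p" using k False by auto
        then show ?thesis by (simp add: m_def power_add)
      qed simp
    qed auto
    also have "\<dots> = (\<Sum>k\<in>?I. of_int (if k \<le> q then int q - int k else 0) * m k)"
      by (rule sum.mono_neutral_cong_left) (auto simp: of_nat_diff)
    finally show ?thesis .
  qed
  have 3: "of_nat (min p q) * y ^ (p - 1) * w ^ (q - 1) =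
      (\<Sum>k\<in>?I. of_int (if k = p then int (min p q) else 0) * m k)"
  proof (cases "p = 0 \<or> q = 0")
    case False
    then have "(\<Sum>k\<in>?I. of_int (if k = p then int (min p q) else 0) * m k) =
        (\<Sum>k\<in>{p}. of_nat (min p q) * m k)"
      by (intro sum.mono_neutral_cong_right) auto
    then show ?thesis by (simp add: m_def)
  next
    case True
    then have "(\<Sum>k\<in>?I. of_int (if k = p then int (min p q) else 0) * m k) = 0"
      by (intro sum.neutral) auto
    then show ?thesis using True by auto
  qed
  have 4: "between_sum y w p q =
      (\<Sum>k\<in>?I. of_int (if min p q < k \<and> k < max p q then \<bar>int k - int q\<bar> else 0) * m k)"
    unfolding between_sum_def by (rule sum.mono_neutral_cong_left) (auto simp: m_def)
  have 5: "w ^ q * (\<Sum>k\<in>{1..<p}. of_nat k * w ^ (p - k - 1) * y ^ (k - 1)) =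
      (\<Sum>k\<in>?I. of_int (if k < p then int k else 0) * m k)"
    unfolding sum_distrib_left
  proof (rule sum.mono_neutral_cong_left)
    fix k assume "k \<in> {1..<p}"
    then have "p + q - k - 1 = q + (p - k - 1)" by auto
    then have "m k = y ^ (k - 1) * (w ^ q * w ^ (p - k - 1))"
      by (simp only: m_def power_add)
    then show "w ^ q * (of_nat k * w ^ (p - k - 1) * y ^ (k - 1)) =
        of_int (if k < p then int k else 0) * m k"
      using \<open>k \<in> {1..<p}\<close> by simp
  qed auto
  have "(if k \<le> p then int q else 0) - (if k \<le> q then int q - int k else 0) =
      (if k = p then int (min p q) else 0)
        - (if min p q < k \<and> k < max p q then \<bar>int k - int q\<bar> else 0)
        + (if k < p then int k else 0)" for k
    by (cases "k < p"; cases "k = p"; cases "k < q"; cases "k = q") (simp_all add: min_def max_def)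
  then show ?thesis
    unfolding 1 2 3 4 5 sum_subtractf[symmetric] sum.distrib[symmetric]
      left_diff_distrib[symmetric] distrib_right[symmetric]
      of_int_diff[symmetric] of_int_add[symmetric]
    by (simp only:)
qed

text \<open>After \<open>divided_difference_pair\<close> the leftover terms factor into a function
  of \<open>p\<close> times \<open>B q * w ^ q\<close>, and their sum over \<open>q\<close> is zero.
  This is where the curve equation at (z,w) enters.\<close>

lemma divided_difference_bilinear:
  assumes "(\<Sum>q\<le>a. B q * w ^ q) = 0"
  shows "(\<Sum>p\<le>a. C p * (\<Sum>k<p. w ^ (p - Suc k) * y ^ k)) * (\<Sum>q\<le>a. B q * (of_nat q * w ^ (q - 1)))
     - (\<Sum>q\<le>a. B q * (\<Sum>k<q. of_nat (q - Suc k) * w ^ (q - Suc k - 1) * y ^ k)) * (\<Sum>p\<le>a. C p * w ^ p)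
   = (\<Sum>p\<le>a. \<Sum>q\<le>a. C p * B q * (of_nat (min p q) * y ^ (p - 1) * w ^ (q - 1) - between_sum y w p q))"
    (is "?L = ?R")
proof -
  define T where "T p = (\<Sum>k\<in>{1..<p}. of_nat k * w ^ (p - k - 1) * y ^ (k - 1))" for p
  have "?L = (\<Sum>p\<le>a. \<Sum>q\<le>a. C p * B q * 
    ((\<Sum>k<p. w ^ (p - Suc k) * y ^ k) * (of_nat q * w ^ (q - 1))
     - (\<Sum>k<q. of_nat (q - Suc k) * w ^ (q - Suc k - 1) * y ^ k) * w ^ p))"
    unfolding sum_product
    by (subst (2) sum.swap, unfold sum_subtractf[symmetric], intro sum.cong refl) algebra
  also have "\<dots> = ?R + (\<Sum>p\<le>a. \<Sum>q\<le>a. (C p * T p) * (B q * w ^ q))"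
    unfolding divided_difference_pair T_def[symmetric] sum.distrib[symmetric]
    by (intro sum.cong refl) (simp add: algebra_simps)
  also have "(\<Sum>p\<le>a. \<Sum>q\<le>a. (C p * T p) * (B q * w ^ q)) = 0"
    by (simp only: assms sum_distrib_left[symmetric] mult_zero_right sum.neutral_const)
  finally show ?thesis by simp
qed

section \<open>Column forms of F and of the derivative of Omega\<close>

lemma cab_F_eq_col: "cab_F a b c x y = (\<Sum>u\<le>a. col_poly a b c u x * y ^ u)"
  by (simp add: cab_F_def sum_cab_D col_poly_def sum_distrib_right)

lemma cab_Fy_eq_col: "cab_Fy a b c x y = (\<Sum>u\<le>a. col_poly a b c u x * (of_nat u * y ^ (u - 1)))"
  by (simp add: cab_Fy_eq sum_cab_D col_poly_def sum_distrib_right)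

text \<open>The free factor \<open>f j\<close> lets one Taylor expansion serve both for powers of
  \<open>w\<close> and for divided differences.\<close>

lemma sum_col_tangent:
  "(\<Sum>u\<le>a. col_tangent a b c u x z * f u) =
     (\<Sum>(i, j)\<in>cab_D a b. c i j * z ^ i * f j)
     + (x - z) * (\<Sum>(i, j)\<in>cab_D a b. c i j * (of_nat i * z ^ (i - 1)) * f j)"
  by (simp add: sum_cab_D col_tangent_def sum_distrib_right sum_distrib_left sum.distrib[symmetric]
      algebra_simps)

text \<open>By the quotient rule the numerator is (H + (x-z) H_z) F_w - H_w (x-z) F_z. Adding F(z,w)
  = 0 to the last factor makes it a Taylor polynomial too; both are then sums over the C_p and
  \<open>divided_difference_bilinear\<close> applies.\<close>

lemma cab_ddz_Omega:
  assumes F0: "cab_F a b c z w = 0" and "x \<noteq> z" "cab_Fy a b c x y \<noteq> 0" "cab_Fy a b c z w \<noteq> 0"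
  shows "cab_ddz a b c (cab_Omega a b c (x, y)) (z, w)
      * ((x - z)\<^sup>2 * cab_Fy a b c x y * cab_Fy a b c z w)
    = (\<Sum>p\<le>a. \<Sum>q\<le>a. col_tangent a b c p x z * col_poly a b c q z
        * (of_nat (min p q) * y ^ (p - 1) * w ^ (q - 1) - between_sum y w p q))"
proof -
  define H where "H = cab_H a b c z y w"
  define Hz where
    "Hz = (\<Sum>(i, j)\<in>cab_D a b. c i j * (of_nat i * z ^ (i - 1)) * (\<Sum>k<j. w ^ (j - Suc k) * y ^ k))"
  define Hw where
    "Hw = (\<Sum>(i, j)\<in>cab_D a b. c i j * z ^ i
       * (\<Sum>k<j. of_nat (j - Suc k) * w ^ (j - Suc k - 1) * y ^ k))"
  let ?Fy = "cab_Fy a b c x y" and ?Fw = "cab_Fy a b c z w" and ?Fz = "cab_Fx a b c z w"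
  have "((\<lambda>\<zeta>. cab_H a b c \<zeta> y w) has_field_derivative Hz) (at z)"
    unfolding cab_H_poly Hz_def case_prod_beta
    by (auto intro!: derivative_eq_intros sum.cong)
  then have "((\<lambda>\<zeta>. cab_Omega a b c (x, y) (\<zeta>, w)) has_field_derivative
      (Hz * ((x - z) * ?Fy) + H * ?Fy) / ((x - z) * ?Fy)\<^sup>2) (at z)"
    using assms unfolding cab_Omega_def case_prod_conv
    by (auto intro!: derivative_eq_intros simp: H_def power2_eq_square)
  then have 1: "deriv (\<lambda>\<zeta>. cab_Omega a b c (x, y) (\<zeta>, w)) z =
      (Hz * ((x - z) * ?Fy) + H * ?Fy) / ((x - z) * ?Fy)\<^sup>2"
    by (rule DERIV_imp_deriv)
  have "((\<lambda>\<omega>. cab_H a b c z y \<omega>) has_field_derivative Hw) (at w)"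
    unfolding cab_H_poly Hw_def case_prod_beta
    by (auto intro!: derivative_eq_intros sum.cong)
  then have "((\<lambda>\<omega>. cab_Omega a b c (x, y) (z, \<omega>)) has_field_derivative
      Hw / ((x - z) * ?Fy)) (at w)"
    using assms unfolding cab_Omega_def case_prod_conv by (auto intro!: derivative_eq_intros)
  then have 2: "deriv (\<lambda>\<omega>. cab_Omega a b c (x, y) (z, \<omega>)) w = Hw / ((x - z) * ?Fy)"
    by (rule DERIV_imp_deriv)
  have "cab_ddz a b c (cab_Omega a b c (x, y)) (z, w) * ((x - z)\<^sup>2 * ?Fy * ?Fw) =
      (H + (x - z) * Hz) * ?Fw - Hw * (cab_F a b c z w + (x - z) * ?Fz)"
  proof -
    \<comment> \<open>The rational identity is isolated with atomic \<open>h\<close>,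
      \<open>A\<close>, \<open>B\<close>, \<open>Z\<close>; the \<open>0\<close> holds the place of
      F(z,w).\<close>
    have "((Hz * (h * A) + H * A) / (h * A)\<^sup>2 + Hw / (h * A) * (- Z / B)) * (h\<^sup>2 * A * B) =
        (H + h * Hz) * B - Hw * (0 + h * Z)" if "h \<noteq> 0" "A \<noteq> 0" "B \<noteq> 0" for h A B Z
      using that by (simp add: field_simps power2_eq_square)
    from this[of "x - z" ?Fy ?Fw ?Fz] show ?thesis
      unfolding cab_ddz_def case_prod_conv 1 2 F0 using assms(2-4) by simp
  qed
  moreover have "H + (x - z) * Hz =
      (\<Sum>p\<le>a. col_tangent a b c p x z * (\<Sum>k<p. w ^ (p - Suc k) * y ^ k))"
    unfolding sum_col_tangent H_def Hz_def cab_H_poly ..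
  moreover have "cab_F a b c z w + (x - z) * ?Fz = (\<Sum>p\<le>a. col_tangent a b c p x z * w ^ p)"
    unfolding sum_col_tangent cab_F_def cab_Fx_eq ..
  moreover have "Hw = (\<Sum>q\<le>a. col_poly a b c q z
      * (\<Sum>k<q. of_nat (q - Suc k) * w ^ (q - Suc k - 1) * y ^ k))"
    by (simp add: Hw_def sum_cab_D col_poly_def sum_distrib_right)
  moreover have "(\<Sum>q\<le>a. col_poly a b c q z * w ^ q) = 0"
    using F0 by (simp add: cab_F_eq_col)
  ultimately show ?thesis
    using divided_difference_bilinear[of "\<lambda>q. col_poly a b c q z" w a "\<lambda>p. col_tangent a b c p x z" y]
    by (simp add: cab_Fy_eq_col)
qed

section \<open>Rounded exponents\<close>

text \<open>As M' = dn - M, the quotients add up to n if d divides M; otherwise the remainders add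
  up to d and the quotients to n - 1.\<close>

lemma complementary_div_mod:
  fixes d :: nat
  assumes "0 < d" and M: "M + M' = d * n"
  shows "M mod d = 0 \<Longrightarrow> M' mod d = 0 \<and> M' div d = n - M div d \<and> M div d \<le> n"
    and "M mod d \<noteq> 0 \<Longrightarrow> M' mod d = d - M mod d \<and> M' div d = n - M div d - 1 \<and> M div d < n"
proof -
  define q where "q = M div d"
  define \<rho> where "\<rho> = M mod d"
  have M_eq: "M = d * q + \<rho>" and \<rho>: "\<rho> < d"
    using assms by (auto simp: q_def \<rho>_def)
  show "M' mod d = 0 \<and> M' div d = n - M div d \<and> M div d \<le> n" if "M mod d = 0"
  proof -
    have "\<rho> = 0" using that by (simp add: \<rho>_def)
    have "d * q \<le> d * n" using M M_eq by linarith
    then have "q \<le> n" using assms by simp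
    moreover have "M' = d * (n - q)"
      using \<open>\<rho> = 0\<close> M unfolding M_eq diff_mult_distrib2 by linarith
    ultimately show ?thesis using assms(1) by (simp flip: q_def)
  qed
  show "M' mod d = d - M mod d \<and> M' div d = n - M div d - 1 \<and> M div d < n" if "M mod d \<noteq> 0"
  proof -
    have "0 < \<rho>" using that by (simp add: \<rho>_def)
    then have "d * q < d * n" using M M_eq by linarith
    then have "q < n" by simp
    then obtain m where m: "n = q + Suc m" using less_iff_Suc_add by auto
    have "M' = d * m + (d - \<rho>)"
      using M \<rho> unfolding m M_eq add_mult_distrib2 mult_Suc_right by linarith
    moreover have "d - \<rho> < d" using \<open>0 < \<rho>\<close> assms(1) by simp
    ultimately show ?thesis using m by (simp flip: q_def \<rho>_def)
  qed
qed

text \<open>Exchanging \<open>x\<close> and \<open>z\<close> reflects the interpolation point M/d to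
  n - M/d = M'/d, and the neighbouring monomials trade places.\<close>

lemma rounding_term_commute:
  assumes "0 < d" and "M + M' = d * n"
  shows "rounding_term x z d M n = rounding_term z x d M' n"
  using complementary_div_mod[OF assms] assms(1)
    mod_less_divisor[OF assms(1), of M]
  by (cases "M mod d = 0") (simp_all add: rounding_term_def mult_ac Suc_diff_Suc less_imp_le)

lemma floor_quot_eq: "floor_quot \<alpha> \<beta> = \<alpha> div \<beta>"
  by (simp add: floor_quot_def floor_divide_of_nat_eq)

lemma ceiling_quot_eq:
  assumes "0 < \<beta>"
  shows "ceiling_quot \<alpha> \<beta> = \<alpha> div \<beta> + (if \<alpha> mod \<beta> = 0 then 0 else 1)"
proof -
  define q where "q = \<alpha> div \<beta>"
  define \<rho> where "\<rho> = \<alpha> mod \<beta>"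
  have "\<alpha> = q * \<beta> + \<rho>" and \<rho>: "\<rho> < \<beta>"
    using assms by (auto simp: q_def \<rho>_def)
  then have "real \<alpha> / real \<beta> = real q + real \<rho> / real \<beta>"
    using assms by (simp add: field_simps)
  moreover have "\<lceil>real q + real \<rho> / real \<beta>\<rceil> = int (q + (if \<rho> = 0 then 0 else 1))"
    using \<rho> by (intro ceiling_unique) (auto simp: field_simps)
  ultimately show ?thesis by (simp add: ceiling_quot_def q_def \<rho>_def)
qed

text \<open>This recovers \<open>rounding_term\<close> from the ceilings and floors of
  \<open>cab_G5\<close>. If d divides M, the upper residue supplies the full weight d and the second
  summand is zero.\<close>

lemma rounding_term_quot:
  assumes "0 < d" and "M + M' = d * n"
  shows "of_nat (mod_upper M d) * z ^ ceiling_quot M d * x ^ floor_quot M' d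
      + of_nat (mod_lower M' d) * z ^ floor_quot M d * x ^ ceiling_quot M' d
    = rounding_term z x d M n"
  using complementary_div_mod[OF assms] assms(1) mod_less_divisor[OF assms(1), of M]
  unfolding rounding_term_def floor_quot_eq ceiling_quot_eq[OF assms(1)] mod_upper_def
  by (cases "M mod d = 0") (simp_all add: mult_ac Suc_diff_Suc less_imp_le)

section \<open>The polynomials \<open>r\<^sub>i\<^sub>j\<close>\<close>

text \<open>Moving the condition into the summand makes the range a product of columns.\<close>

lemma sum_col_pairs:
  "(\<Sum>(r, s)\<in>{(r, s). (r, u) \<in> cab_D a b \<and> (s, v) \<in> cab_D a b \<and> Q r s}. g r s) =
    (\<Sum>r\<in>cab_col a b u. \<Sum>s\<in>cab_col a b v. if Q r s then g r s else 0)"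
  unfolding sum.cartesian_product
  by (rule sum.mono_neutral_cong_left) (auto simp: cab_col_def[symmetric] simp del: finite_cab_col
      intro: finite_cartesian_product finite_cab_col, auto simp: cab_col_def split: if_splits)

text \<open>The quotient of the last two numerical parameters before \<open>(r + s)\<close>, M over
  d, is the abscissa at height \<open>k\<close> of the line through (r,u) and (s,v);
  \<open>k\<close> stands for j + 1.\<close>

definition weight_sum ::
    "nat \<Rightarrow> nat \<Rightarrow> (nat \<Rightarrow> nat \<Rightarrow> complex) \<Rightarrow> complex \<Rightarrow> nat \<Rightarrow> nat \<Rightarrow> nat \<Rightarrow> nat \<Rightarrow> complex" where
  "weight_sum a b c z u v k i = (\<Sum>r\<in>cab_col a b u. \<Sum>s\<in>cab_col a b v.
     c r u * c s v * truncated_weight z (v - u) ((k - u) * s + (v - k) * r) (r + s) i)"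

definition diag_weight_sum ::
    "nat \<Rightarrow> nat \<Rightarrow> (nat \<Rightarrow> nat \<Rightarrow> complex) \<Rightarrow> complex \<Rightarrow> nat \<Rightarrow> nat \<Rightarrow> nat \<Rightarrow> complex" where
  "diag_weight_sum a b c z p q i = (\<Sum>r\<in>cab_col a b p. \<Sum>s\<in>cab_col a b q.
     c r p * c s q * truncated_weight z 1 r (r + s) i)"

definition rounding_sum ::
    "nat \<Rightarrow> nat \<Rightarrow> (nat \<Rightarrow> nat \<Rightarrow> complex) \<Rightarrow> complex \<Rightarrow> complex \<Rightarrow> nat \<Rightarrow> nat \<Rightarrow> nat \<Rightarrow> complex" where
  "rounding_sum a b c x z u v k = (\<Sum>r\<in>cab_col a b u. \<Sum>s\<in>cab_col a b v.
     c r u * c s v * rounding_term x z (v - u) ((k - u) * s + (v - k) * r) (r + s))"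

text \<open>The first two sums of \<open>cab_r\<close> join into one over all columns
  \<open>q\<close>, since their factors \<open>u\<close> and \<open>j + 1\<close> are both
  \<open>min (Suc j) q\<close>. Weakening the bound \<open>i + 2\<close> to \<open>i + 1\<close>
  adds at most terms with coefficient zero.\<close>

lemma cab_r_eq:
  assumes "j < a"
  shows "cab_r a b c i j (z, w) =
    - (\<Sum>q\<le>a. of_nat (min (Suc j) q) * w ^ (q - 1) * diag_weight_sum a b c z (Suc j) q i)
    + (\<Sum>(u, v)\<in>less_pairs a. (if u < Suc j \<and> Suc j < v then w ^ (u + v - Suc j - 1) else 0)
         * weight_sum a b c z u v (Suc j) i)"
proof -
  let ?f = "\<lambda>q. of_nat (min (Suc j) q) * w ^ (q - 1) * diag_weight_sum a b c z (Suc j) q i"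
  have 1: "(\<Sum>(r, s)\<in>{(r, s). (r, u) \<in> cab_D a b \<and> (s, j + 1) \<in> cab_D a b \<and> i + 2 \<le> s}.
        c r u * c s (j + 1) * of_nat u * (of_nat s - of_nat i - 1)
          * z ^ (r + s - i - 2) * w ^ (u - 1)) = - ?f u" if "u \<in> {0..j}" for u
    unfolding sum_col_pairs diag_weight_sum_def truncated_weight_def
    by (subst sum.swap, unfold sum_distrib_left sum_negf[symmetric])
      (use that in \<open>auto intro!: sum.cong simp: min_def algebra_simps not_le less_Suc_eq\<close>)
  have 2: "(\<Sum>(r, s)\<in>{(r, s). (r, j + 1) \<in> cab_D a b \<and> (s, v) \<in> cab_D a b \<and> i + 2 \<le> r}.
        c r (j + 1) * c s v * (of_nat j + 1) * (of_nat r - of_nat i - 1)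
          * z ^ (r + s - i - 2) * w ^ (v - 1)) = - ?f v" if "v \<in> {j + 1..a}" for v
    unfolding sum_col_pairs diag_weight_sum_def truncated_weight_def
    by (unfold sum_distrib_left sum_negf[symmetric])
      (use that in \<open>auto intro!: sum.cong simp: min_def algebra_simps not_le less_Suc_eq\<close>)
  have 3: "(\<Sum>(r, s)\<in>{(r, s). (r, u) \<in> cab_D a b \<and> (s, v) \<in> cab_D a b
            \<and> (j + 1 - u) * s + (v - j - 1) * r \<ge> (i + 1) * (v - u) \<and> r + s \<ge> i + 2}.
        c r u * c s v
          * ((of_nat i + 1) * (of_nat v - of_nat u)
             - (of_nat j + 1 - of_nat u) * of_nat s
             - (of_nat v - of_nat j - 1) * of_nat r)
          * z ^ (r + s - i - 2) * w ^ (u + v - j - 2)) =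
      w ^ (u + v - Suc j - 1) * weight_sum a b c z u v (Suc j) i"
    if "u \<in> {0..j}" "v \<in> {j + 2..a}" for u v
  proof -
    have *: "of_nat v - of_nat u = (of_nat (v - u) :: complex)"
      "of_nat j + 1 - of_nat u = (of_nat (Suc j - u) :: complex)"
      "of_nat v - of_nat j - 1 = (of_nat (v - Suc j) :: complex)"
      "u + v - j - 2 = u + v - Suc j - 1" "v - j - 1 = v - Suc j" "j + 1 - u = Suc j - u"
      using that by (auto simp: of_nat_diff)
    have **: "(of_nat i + 1) * D - e * of_nat s - f * of_nat r =
        (of_nat i + 1) * D - (e * of_nat s + f * of_nat r)" for D e f :: complex and r s
      by simp
    show ?thesis
      unfolding sum_col_pairs weight_sum_def truncated_weight_def * ** sum_distrib_left
        of_nat_add of_nat_mult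
      by (intro sum.cong refl) (simp add: mult_ac)
  qed
  have "(\<Sum>u\<in>{0..j}. - ?f u) + (\<Sum>v\<in>{j + 1..a}. - ?f v) = (\<Sum>q\<in>{0..j} \<union> {j + 1..a}. - ?f q)"
    by (rule sum.union_disjoint[symmetric]) auto
  also have "{0..j} \<union> {j + 1..a} = {..a}"
    using assms by auto
  finally have 4: "(\<Sum>u\<in>{0..j}. - ?f u) + (\<Sum>v\<in>{j + 1..a}. - ?f v) = - (\<Sum>q\<le>a. ?f q)"
    by (simp only: sum_negf)
  have "(\<Sum>u\<in>{0..j}. \<Sum>v\<in>{j + 2..a}. w ^ (u + v - Suc j - 1) * weight_sum a b c z u v (Suc j) i) =
    (\<Sum>(u, v)\<in>{0..j} \<times> {j + 2..a}. w ^ (u + v - Suc j - 1) * weight_sum a b c z u v (Suc j) i)"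
    by (rule sum.cartesian_product)
  also have "\<dots> = (\<Sum>(u, v)\<in>less_pairs a.
      (if u < Suc j \<and> Suc j < v then w ^ (u + v - Suc j - 1) else 0)
        * weight_sum a b c z u v (Suc j) i)"
    by (rule sum.mono_neutral_cong_left) (auto split: if_splits)
  finally have 5: "(\<Sum>u\<in>{0..j}. \<Sum>v\<in>{j + 2..a}.
      w ^ (u + v - Suc j - 1) * weight_sum a b c z u v (Suc j) i) = \<dots>" .
  show ?thesis
    unfolding cab_r_def case_prod_conv 4[symmetric] 5[symmetric]
    by (intro arg_cong2[of _ _ _ _ "(+)"] sum.cong refl 1 2 3)
qed

text \<open>For \<open>d = 1\<close> nothing is rounded: the rounding term is x^r z^s, which leaves
  the negated Taylor remainder of column \<open>p\<close>.\<close>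

lemma weighted_sum_diag_weight_sum:
  "weighted_sum x z b (diag_weight_sum a b c z p q) =
    (col_tangent a b c p x z - col_poly a b c p x) * col_poly a b c q z"
proof -
  have "weighted_sum x z b (diag_weight_sum a b c z p q) =
      (\<Sum>r\<in>cab_col a b p. \<Sum>s\<in>cab_col a b q. c r p * c s q *
        weighted_sum x z b (truncated_weight z 1 r (r + s)))"
    unfolding diag_weight_sum_def by (simp only: weighted_sum_sum weighted_sum_cmult)
  also have "\<dots> = (\<Sum>r\<in>cab_col a b p. \<Sum>s\<in>cab_col a b q.
      (c r p * (z ^ r + of_nat r * (x - z) * z ^ (r - 1)) - c r p * x ^ r) * (c s q * z ^ s))"
  proof (intro sum.cong refl)
    fix r s assume "r \<in> cab_col a b p"
    then have "r \<le> b" by (rule cab_col_le)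
    then have "weighted_sum x z b (truncated_weight z 1 r (r + s)) =
        z ^ (r + s) + of_nat r * (x - z) * z ^ (r + s - 1) - x ^ r * z ^ s"
      by (subst weighted_sum_truncated_weight) (auto simp: rounding_term_def)
    also have "of_nat r * (x - z) * z ^ (r + s - 1) = of_nat r * (x - z) * z ^ (r - 1) * z ^ s"
      by (cases r) (simp_all add: power_add)
    finally have W: "weighted_sum x z b (truncated_weight z 1 r (r + s)) =
        z ^ r * z ^ s + of_nat r * (x - z) * z ^ (r - 1) * z ^ s - x ^ r * z ^ s"
      by (simp only: power_add)
    show "c r p * c s q * weighted_sum x z b (truncated_weight z 1 r (r + s)) =
        (c r p * (z ^ r + of_nat r * (x - z) * z ^ (r - 1)) - c r p * x ^ r) * (c s q * z ^ s)"
      unfolding W by (simp add: algebra_simps)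
  qed
  finally show ?thesis
    by (simp add: col_tangent_def col_poly_def sum_product sum_subtractf[symmetric])
qed

text \<open>In M = e s + f r the first share puts the derivative on column \<open>v\<close>, the
  second on column \<open>u\<close>. The resulting products are those of
  \<open>sum_between_sum\<close>, against which they cancel later.\<close>

lemma weighted_sum_weight_sum:
  assumes "u < k" "k < v"
  shows "weighted_sum x z b (weight_sum a b c z u v k) =
    of_nat (k - u) * col_poly a b c u z * col_tangent a b c v x z
    + of_nat (v - k) * col_tangent a b c u x z * col_poly a b c v z
    - rounding_sum a b c x z u v k"
proof -
  define e f where "e = k - u" and "f = v - k"
  have d: "v - u = e + f" and ef: "0 < e + f"
    using assms by (auto simp: e_def f_def)
  have "weighted_sum x z b (weight_sum a b c z u v k) =
      (\<Sum>r\<in>cab_col a b u. \<Sum>s\<in>cab_col a b v. c r u * c s v *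
        weighted_sum x z b (truncated_weight z (e + f) (e * s + f * r) (r + s)))"
    unfolding weight_sum_def e_def[symmetric] f_def[symmetric] d
    by (simp only: weighted_sum_sum weighted_sum_cmult)
  also have "\<dots> = (\<Sum>r\<in>cab_col a b u. \<Sum>s\<in>cab_col a b v.
      of_nat e * (c r u * z ^ r) * (c s v * (z ^ s + of_nat s * (x - z) * z ^ (s - 1)))
      + of_nat f * (c r u * (z ^ r + of_nat r * (x - z) * z ^ (r - 1))) * (c s v * z ^ s)
      - c r u * c s v * rounding_term x z (e + f) (e * s + f * r) (r + s))"
  proof (intro sum.cong refl)
    fix r s assume "r \<in> cab_col a b u" "s \<in> cab_col a b v"
    then have "r \<le> b" "s \<le> b" by (auto dest: cab_col_le)
    \<comment> \<open>A weighted mean of \<open>r\<close> and \<open>s\<close> is at most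
      \<open>b\<close>, so summation up to \<open>b\<close> reaches the kink.\<close>
    then have "e * s + f * r \<le> (e + f) * b"
      unfolding add_mult_distrib by (intro add_mono mult_le_mono) auto
    moreover have "e * s + f * r \<le> (e + f) * (r + s)"
      by (simp add: algebra_simps)
    ultimately have W: "weighted_sum x z b (truncated_weight z (e + f) (e * s + f * r) (r + s)) =
        of_nat (e + f) * z ^ (r + s) + of_nat (e * s + f * r) * (x - z) * z ^ (r + s - 1)
          - rounding_term x z (e + f) (e * s + f * r) (r + s)"
      using ef by (subst weighted_sum_truncated_weight) auto
    have r: "of_nat r * z ^ (r + s - 1) = of_nat r * z ^ (r - 1) * z ^ s"
      by (cases r) (simp_all add: power_add)
    have s: "of_nat s * z ^ (r + s - 1) = of_nat s * z ^ (s - 1) * z ^ r"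
      by (cases s) (simp_all add: power_add)
    have "of_nat (e * s + f * r) * (x - z) * z ^ (r + s - 1) =
        (x - z) * (of_nat e * (of_nat s * z ^ (r + s - 1)) + of_nat f * (of_nat r * z ^ (r + s - 1)))"
      by (simp add: algebra_simps)
    also have "\<dots> = (x - z) * (of_nat e * (of_nat s * z ^ (s - 1) * z ^ r)
        + of_nat f * (of_nat r * z ^ (r - 1) * z ^ s))"
      unfolding r s ..
    finally have D: "of_nat (e * s + f * r) * (x - z) * z ^ (r + s - 1) = \<dots>" .
    show "c r u * c s v * weighted_sum x z b (truncated_weight z (e + f) (e * s + f * r) (r + s)) =
      of_nat e * (c r u * z ^ r) * (c s v * (z ^ s + of_nat s * (x - z) * z ^ (s - 1)))
      + of_nat f * (c r u * (z ^ r + of_nat r * (x - z) * z ^ (r - 1))) * (c s v * z ^ s)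
      - c r u * c s v * rounding_term x z (e + f) (e * s + f * r) (r + s)"
      unfolding W D by (simp add: power_add algebra_simps)
  qed
  finally show ?thesis
    unfolding col_tangent_def col_poly_def rounding_sum_def e_def[symmetric] f_def[symmetric] d
      mult.assoc sum_product
    unfolding sum_distrib_left sum_subtractf[symmetric] sum.distrib[symmetric] mult.assoc .
qed

text \<open>Here (i+1, j+1) violates the linear inequality of D, and every index set of pairs is
  empty: the first two sums would need a point of D further right at the same height, the third a
  segment with ends in D passing through or right of that point, against convexity.\<close>

lemma cab_r_eq_0:
  assumes "(i, j) \<notin> cab_J a b"
  shows "cab_r a b c i j (z, w) = 0"
proof -
  have J: "\<not> a * (i + 1) + b * (j + 1) \<le> a * b"
    using assms by (simp add: cab_J_def algebra_simps)
  have col: "(s, j + 1) \<in> cab_D a b \<Longrightarrow> \<not> i + 2 \<le> s" for s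
  proof
    assume "(s, j + 1) \<in> cab_D a b" "i + 2 \<le> s"
    then have "a * s + b * (j + 1) \<le> a * b" "a * (i + 1) \<le> a * s"
      by (auto simp: cab_D_def simp del: mult_Suc_right intro!: mult_le_mono)
    then show False using J by linarith
  qed
  have interior: "\<not> (i + 1) * (v - u) \<le> (j + 1 - u) * s + (v - j - 1) * r"
    if D: "(r, u) \<in> cab_D a b" "(s, v) \<in> cab_D a b" and uv: "u \<in> {0..j}" "v \<in> {j + 2..a}" for u v r s
  proof
    assume le: "(i + 1) * (v - u) \<le> (j + 1 - u) * s + (v - j - 1) * r"
    define e f where "e = j + 1 - u" and "f = v - j - 1"
    have j: "j + 1 = u + e" and v: "v = u + e + f" and ef: "0 < e + f"
      using uv by (auto simp: e_def f_def)
    have le': "(i + 1) * (e + f) \<le> e * s + f * r"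
      using le unfolding e_def[symmetric] f_def[symmetric] by (simp add: v)
    \<comment> \<open>The inequalities for the two ends are averaged with weights \<open>e\<close>
      and \<open>f\<close>, scaled by \<open>e + f\<close> to avoid division.\<close>
    have "(e + f) * (a * (i + 1) + b * (u + e)) = a * ((i + 1) * (e + f)) + (e * (b * v) + f * (b * u))"
      unfolding v by (simp add: algebra_simps)
    also have "\<dots> \<le> a * (e * s + f * r) + (e * (b * v) + f * (b * u))"
      using le' by simp
    also have "\<dots> = e * (a * s + b * v) + f * (a * r + b * u)"
      by (simp add: algebra_simps)
    also have "\<dots> \<le> e * (a * b) + f * (a * b)"
      using D by (intro add_mono mult_le_mono) (auto simp: cab_D_def)
    finally have "(e + f) * (a * (i + 1) + b * (u + e)) \<le> (e + f) * (a * b)"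
      by (simp add: algebra_simps)
    then show False using J ef unfolding j by simp
  qed
  show ?thesis
    unfolding cab_r_def case_prod_conv sum_col_pairs
    by (intro add_eq_0_iff[THEN iffD2]) (use col interior in \<open>auto simp: cab_col_def intro!: sum.neutral\<close>)
qed

section \<open>Summation over J(a,b)\<close>

lemma cab_J_subset:
  assumes "0 < a" "0 < b"
  shows "cab_J a b \<subseteq> {..<b} \<times> {..<a}"
proof clarify
  fix i j assume "(i, j) \<in> cab_J a b"
  then have "a * Suc i \<le> a * b" "b * Suc j \<le> b * a"
    by (simp_all add: cab_J_def mult.commute)
  then show "i \<in> {..<b} \<and> j \<in> {..<a}"
    using assms by (simp add: Suc_le_eq del: mult_Suc_right)
qed

lemma sum_lessThan_shift:
  fixes f :: "nat \<Rightarrow> 'a :: comm_monoid_add"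
  assumes "f 0 = 0"
  shows "(\<Sum>j<a. f (Suc j)) = (\<Sum>p\<le>a. f p)"
  using assms by (simp add: sum.lessThan_Suc_shift flip: lessThan_Suc_atMost del: sum.lessThan_Suc)

text \<open>By \<open>cab_r_eq_0\<close> the sum may run over a full rectangle; for fixed
  \<open>j\<close> the sum over \<open>i\<close> is then a \<open>weighted_sum\<close>, and its
  linearity separates the two kinds of weights.\<close>

lemma cab_r_sum:
  assumes "0 < a" "0 < b"
  shows "(x - z)\<^sup>2 * (\<Sum>(i, j)\<in>cab_J a b. x ^ i * y ^ j * cab_r a b c i j (z, w)) =
    (\<Sum>p\<le>a. \<Sum>q\<le>a. (col_poly a b c p x - col_tangent a b c p x z) * col_poly a b c q z
       * (of_nat (min p q) * y ^ (p - 1) * w ^ (q - 1)))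
    + (\<Sum>(u, v)\<in>less_pairs a. \<Sum>k\<in>{u<..<v}.
         weighted_sum x z b (weight_sum a b c z u v k) * (y ^ (k - 1) * w ^ (u + v - k - 1)))"
proof -
  define W where "W u v k = weighted_sum x z b (weight_sum a b c z u v k)" for u v k
  \<comment> \<open>The contribution of the row \<open>j = p - 1\<close>; it is zero at
    \<open>p = 0\<close>, so that row can be added after the shift.\<close>
  define g where "g p = y ^ (p - 1) *
    (- (\<Sum>q\<le>a. of_nat (min p q) * w ^ (q - 1)
          * ((col_tangent a b c p x z - col_poly a b c p x) * col_poly a b c q z))
     + (\<Sum>(u, v)\<in>less_pairs a. (if u < p \<and> p < v then w ^ (u + v - p - 1) else 0) * W u v p))" for p
  have "(\<Sum>(i, j)\<in>cab_J a b. x ^ i * y ^ j * cab_r a b c i j (z, w)) =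
      (\<Sum>(i, j)\<in>{..<b} \<times> {..<a}. x ^ i * y ^ j * cab_r a b c i j (z, w))"
    using cab_J_subset[OF assms] cab_r_eq_0[of _ _ a b c z w] by (intro sum.mono_neutral_left) auto
  also have "\<dots> = (\<Sum>j<a. \<Sum>i<b. x ^ i * y ^ j * cab_r a b c i j (z, w))"
    by (simp add: sum.cartesian_product[symmetric] sum.swap[of _ "{..<a}"])
  finally have "(x - z)\<^sup>2 * (\<Sum>(i, j)\<in>cab_J a b. x ^ i * y ^ j * cab_r a b c i j (z, w)) =
      (\<Sum>j<a. y ^ j * weighted_sum x z b (\<lambda>i. cab_r a b c i j (z, w)))"
    by (simp add: weighted_sum_def sum_distrib_left mult_ac)
  also have "\<dots> = (\<Sum>j<a. g (Suc j))"
  proof (intro sum.cong refl)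
    fix j assume "j \<in> {..<a}"
    then have "weighted_sum x z b (\<lambda>i. cab_r a b c i j (z, w)) =
        weighted_sum x z b (\<lambda>i. - (\<Sum>q\<le>a. of_nat (min (Suc j) q) * w ^ (q - 1)
            * diag_weight_sum a b c z (Suc j) q i)
          + (\<Sum>(u, v)\<in>less_pairs a. (if u < Suc j \<and> Suc j < v then w ^ (u + v - Suc j - 1) else 0)
              * weight_sum a b c z u v (Suc j) i))"
      by (simp only: cab_r_eq lessThan_iff)
    also have "\<dots> = - (\<Sum>q\<le>a. of_nat (min (Suc j) q) * w ^ (q - 1)
          * ((col_tangent a b c (Suc j) x z - col_poly a b c (Suc j) x) * col_poly a b c q z))
        + (\<Sum>(u, v)\<in>less_pairs a. (if u < Suc j \<and> Suc j < v then w ^ (u + v - Suc j - 1) else 0)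
            * W u v (Suc j))"
      unfolding W_def case_prod_beta weighted_sum_add weighted_sum_uminus weighted_sum_sum
        weighted_sum_cmult weighted_sum_diag_weight_sum ..
    finally show "y ^ j * weighted_sum x z b (\<lambda>i. cab_r a b c i j (z, w)) = g (Suc j)"
      by (simp add: g_def)
  qed
  also have "\<dots> = (\<Sum>p\<le>a. g p)"
    by (rule sum_lessThan_shift) (simp add: g_def case_prod_beta)
  also have "\<dots> = (\<Sum>p\<le>a. \<Sum>q\<le>a. (col_poly a b c p x - col_tangent a b c p x z) * col_poly a b c q z
       * (of_nat (min p q) * y ^ (p - 1) * w ^ (q - 1)))
    + (\<Sum>p\<le>a. \<Sum>(u, v)\<in>less_pairs a.
         if u < p \<and> p < v then W u v p * (y ^ (p - 1) * w ^ (u + v - p - 1)) else 0)"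
    unfolding g_def distrib_left sum.distrib
    by (intro arg_cong2[of _ _ _ _ "(+)"] sum.cong refl)
      (auto simp: sum_distrib_left sum_negf[symmetric] algebra_simps intro!: sum.cong)
  also have "(\<Sum>p\<le>a. \<Sum>(u, v)\<in>less_pairs a.
         if u < p \<and> p < v then W u v p * (y ^ (p - 1) * w ^ (u + v - p - 1)) else 0) =
      (\<Sum>(u, v)\<in>less_pairs a. \<Sum>k\<in>{u<..<v}. W u v k * (y ^ (k - 1) * w ^ (u + v - k - 1)))"
    unfolding case_prod_beta
    by (subst sum.swap, intro sum.cong refl sum.mono_neutral_cong_right)
      (auto simp: less_pairs_def)
  finally show ?thesis by (simp only: W_def)
qed

section \<open>The numerator\<close>

text \<open>Each pair collects the terms at \<open>(u, v)\<close> and \<open>(v, u)\<close>, whose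
  coefficients are \<open>v - k\<close> and \<open>k - u\<close>; the diagonal contributes
  nothing.\<close>

lemma sum_between_sum:
  "(\<Sum>p\<le>a. \<Sum>q\<le>a. C p * B q * between_sum y w p q) =
    (\<Sum>(u, v)\<in>less_pairs a. \<Sum>k\<in>{u<..<v}. (of_nat (k - u) * B u * C v + of_nat (v - k) * C u * B v)
       * (y ^ (k - 1) * w ^ (u + v - k - 1)))"
proof -
  have "C u * B v * between_sum y w u v + C v * B u * between_sum y w v u =
      (\<Sum>k\<in>{u<..<v}. (of_nat (k - u) * B u * C v + of_nat (v - k) * C u * B v)
       * (y ^ (k - 1) * w ^ (u + v - k - 1)))" if "u < v" for u v
  proof -
    have mm: "min u v = u" "max u v = v" "min v u = u" "max v u = v"
      using that by auto
    have vu: "v + u - k - 1 = u + v - k - 1" for k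
      by (simp add: add.commute)
    have "of_int \<bar>int k - int v\<bar> = (of_nat (v - k) :: complex)"
      "of_int \<bar>int k - int u\<bar> = (of_nat (k - u) :: complex)" if "k \<in> {u<..<v}" for k
      using that by (auto simp: of_nat_diff)
    then show ?thesis
      unfolding between_sum_def mm vu sum_distrib_left sum.distrib[symmetric]
      by (intro sum.cong refl) (simp add: algebra_simps)
  qed
  then show ?thesis
    unfolding sum_square_less_pairs
    by (auto simp: between_sum_def[of _ _ u u for u] intro!: sum.cong)
qed

lemma cab_G5_eq:
  assumes "u < v"
  shows "cab_G5 a b c (x, y) (z, w) u v =
    - (\<Sum>k\<in>{u<..<v}. rounding_sum a b c z x u v k * (w ^ (k - 1) * y ^ (u + v - k - 1)))"
proof -
  have k: "{u + 1..v - 1} = {u<..<v}"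
    using assms by auto
  have "of_nat (mod_upper ((k - u) * s + (v - k) * r) (v - u))
            * z ^ ceiling_quot ((k - u) * s + (v - k) * r) (v - u)
            * x ^ floor_quot ((k - u) * r + (v - k) * s) (v - u)
          + of_nat (mod_lower ((k - u) * r + (v - k) * s) (v - u))
            * z ^ floor_quot ((k - u) * s + (v - k) * r) (v - u)
            * x ^ ceiling_quot ((k - u) * r + (v - k) * s) (v - u) =
      rounding_term z x (v - u) ((k - u) * s + (v - k) * r) (r + s)" if "k \<in> {u<..<v}" for k r s
  proof (rule rounding_term_quot)
    have "v - u = (k - u) + (v - k)" using that by auto
    then show "(k - u) * s + (v - k) * r + ((k - u) * r + (v - k) * s) = (v - u) * (r + s)"
      by (simp only:) (simp add: algebra_simps del: diff_mult_distrib diff_mult_distrib2)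
  qed (use assms in auto)
  then show ?thesis
    unfolding cab_G5_def case_prod_conv k rounding_sum_def sum_distrib_right
    by (simp add: mult.assoc)
qed

text \<open>Reflecting \<open>k\<close> exchanges the weights \<open>k - u\<close> and
  \<open>v - k\<close>, which turns each M into its complement in (v-u)(r+s).\<close>

lemma rounding_sum_reflect:
  assumes "u < k" "k < v"
  shows "rounding_sum a b c z x u v (u + v - k) = rounding_sum a b c x z u v k"
proof -
  define e f where "e = k - u" and "f = v - k"
  have "v - u = e + f" "u + v - k - u = f" "v - (u + v - k) = e" "0 < e + f"
    using assms by (auto simp: e_def f_def)
  then show ?thesis
    unfolding rounding_sum_def e_def[symmetric] f_def[symmetric]
    by (intro sum.cong refl arg_cong2[of _ _ _ _ "(*)"])
      (simp, rule rounding_term_commute, simp_all add: algebra_simps)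
qed

lemma cab_G5_commute:
  assumes "u < v"
  shows "cab_G5 a b c (x, y) (z, w) u v = cab_G5 a b c (z, w) (x, y) u v"
  unfolding cab_G5_eq[OF assms] neg_equal_iff_equal
  by (rule sum.reindex_bij_witness[of _ "\<lambda>k. u + v - k" "\<lambda>k. u + v - k"])
    (auto simp: rounding_sum_reflect)

text \<open>In \<open>cab_G12\<close> and \<open>cab_G34\<close> the factor \<open>u\<close> is the
  smaller column index, so with the diagonal they form one full bilinear sum.\<close>

lemma cab_G_eq:
  "cab_G a b c (x, y) (z, w) =
    (\<Sum>p\<le>a. \<Sum>q\<le>a. col_poly a b c p x * col_poly a b c q z
       * (of_nat (min p q) * y ^ (p - 1) * w ^ (q - 1)))
    + (\<Sum>(u, v)\<in>less_pairs a. cab_G5 a b c (x, y) (z, w) u v)"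
proof -
  have 12: "cab_G12 a b c (x, y) (z, w) u v =
      col_poly a b c u x * col_poly a b c v z * (of_nat u * y ^ (u - 1) * w ^ (v - 1))" for u v
    unfolding cab_G12_def case_prod_conv col_poly_def sum_product
    by (simp add: sum_distrib_left sum_distrib_right mult_ac)
  have 34: "cab_G34 a b c (x, y) (z, w) u v =
      col_poly a b c v x * col_poly a b c u z * (of_nat u * y ^ (v - 1) * w ^ (u - 1))" for u v
    unfolding cab_G34_def case_prod_conv col_poly_def sum_product
    by (subst (2) sum.swap) (simp add: sum_distrib_left sum_distrib_right mult_ac)
  show ?thesis
    unfolding cab_G_def less_pairs_def[symmetric] 12 34 sum_square_less_pairs
    by (auto simp: atLeast0AtMost case_prod_beta sum.distrib[symmetric] less_pairs_def
        intro!: sum.cong)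
qed

lemma cab_G_commute: "cab_G a b c (x, y) (z, w) = cab_G a b c (z, w) (x, y)"
  unfolding cab_G_eq
  by (intro arg_cong2[of _ _ _ _ "(+)"], subst sum.swap)
    (auto intro!: sum.cong cab_G5_commute simp: min.commute mult_ac)

lemma cab_R_eq:
  assumes "0 < a" "0 < b" and "cab_F a b c z w = 0"
    and nz: "x \<noteq> z" "cab_Fy a b c x y \<noteq> 0" "cab_Fy a b c z w \<noteq> 0"
  shows "cab_R a b c (x, y) (z, w) =
    cab_G a b c (x, y) (z, w) / ((x - z)\<^sup>2 * cab_Fy a b c x y * cab_Fy a b c z w)"
proof -
  let ?N = "(x - z)\<^sup>2 * cab_Fy a b c x y * cab_Fy a b c z w"
  define A where "A p = col_poly a b c p x" for p
  define B where "B p = col_poly a b c p z" for p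
  define C where "C p = col_tangent a b c p x z" for p
  define \<mu> where "\<mu> p q = of_nat (min p q) * y ^ (p - 1) * w ^ (q - 1)" for p q
  define m where "m u v k = y ^ (k - 1) * w ^ (u + v - k - 1)" for u v k
  have "cab_R a b c (x, y) (z, w) * ?N =
      cab_ddz a b c (cab_Omega a b c (x, y)) (z, w) * ?N
      + (x - z)\<^sup>2 * (\<Sum>(i, j)\<in>cab_J a b. x ^ i * y ^ j * cab_r a b c i j (z, w))"
    unfolding cab_R_def case_prod_conv distrib_right
    using nz by (simp add: sum_distrib_left sum_distrib_right case_prod_beta mult_ac)
  also have "\<dots> = (\<Sum>p\<le>a. \<Sum>q\<le>a. C p * B q * (\<mu> p q - between_sum y w p q))
      + ((\<Sum>p\<le>a. \<Sum>q\<le>a. (A p - C p) * B q * \<mu> p q)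
      + (\<Sum>(u, v)\<in>less_pairs a. \<Sum>k\<in>{u<..<v}. weighted_sum x z b (weight_sum a b c z u v k) * m u v k))"
    unfolding cab_ddz_Omega[OF assms(3-6)] cab_r_sum[OF assms(1,2)] A_def B_def C_def \<mu>_def m_def ..
  also have "\<dots> = (\<Sum>p\<le>a. \<Sum>q\<le>a. A p * B q * \<mu> p q)
      + ((\<Sum>(u, v)\<in>less_pairs a. \<Sum>k\<in>{u<..<v}. weighted_sum x z b (weight_sum a b c z u v k) * m u v k)
         - (\<Sum>p\<le>a. \<Sum>q\<le>a. C p * B q * between_sum y w p q))"
    by (simp add: algebra_simps sum.distrib sum_subtractf)
  \<comment> \<open>The tangent products cancel and only rounding sums remain. They carry
    \<open>y ^ (k - 1)\<close>, hence match \<open>cab_G5\<close> with the two points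
    exchanged.\<close>
  also have "(\<Sum>(u, v)\<in>less_pairs a. \<Sum>k\<in>{u<..<v}. weighted_sum x z b (weight_sum a b c z u v k) * m u v k)
         - (\<Sum>p\<le>a. \<Sum>q\<le>a. C p * B q * between_sum y w p q) =
       (\<Sum>(u, v)\<in>less_pairs a. cab_G5 a b c (z, w) (x, y) u v)"
    unfolding sum_between_sum sum_subtractf[symmetric] case_prod_beta m_def[symmetric]
    by (intro sum.cong refl)
      (auto simp: less_pairs_def cab_G5_eq weighted_sum_weight_sum A_def B_def C_def m_def
        sum_subtractf[symmetric] sum_negf[symmetric] algebra_simps intro!: sum.cong)
  also have "\<dots> = (\<Sum>(u, v)\<in>less_pairs a. cab_G5 a b c (x, y) (z, w) u v)"
    by (intro sum.cong refl) (auto intro: cab_G5_commute)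
  finally have "cab_R a b c (x, y) (z, w) * ?N = cab_G a b c (x, y) (z, w)"
    by (simp only: cab_G_eq A_def B_def \<mu>_def)
  then show ?thesis using nz by (simp add: eq_divide_eq)
qed

theorem theorem3p2:
  fixes a b :: nat and c :: "nat \<Rightarrow> nat \<Rightarrow> complex" and x y z w :: complex
  assumes "cab_curve a b c"
    and "cab_F a b c x y = 0" and "cab_F a b c z w = 0"
    and "x \<noteq> z" and "cab_Fy a b c x y \<noteq> 0" and "cab_Fy a b c z w \<noteq> 0"
  shows "cab_R a b c (x, y) (z, w) = cab_R a b c (z, w) (x, y)
    \<and> cab_R a b c (x, y) (z, w) =
        cab_G a b c (x, y) (z, w) / ((x - z)\<^sup>2 * cab_Fy a b c x y * cab_Fy a b c z w)"
proof -
  have ab: "0 < a" "0 < b"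
    using assms(1) by (auto simp: cab_curve_def)
  \<comment> \<open>The closed form is used in both orders; its numerator and denominator are both
    symmetric.\<close>
  show ?thesis
    using cab_R_eq[OF ab assms(3-6)] cab_R_eq[OF ab assms(2) assms(4)[symmetric] assms(6,5)]
    by (simp add: cab_G_commute[of a b c z w] power2_commute[of z x] mult_ac)
qed

end
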